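(* Let $A \in \mathbb{C}^{n\times n}$ be a positive-semidefinite matrix, let $P \in \{0,1\}^{n\times n}$ be a permutation matrix, let $r$ be an approximation rank, and let $(Q_i)_{i=1}^n$ be a sparsity pattern, i.e. index sets $Q_i \subseteq \{1,\ldots,i-1\}$. Let $\hat A_{\rm part}$ be a partial pivoted Cholesky approximation of $A$ with permutation $P$ and approximation rank $r$. Let $\hat A_{\rm res}$ be a Vecchia approximation of the residual $R = A - \hat A_{\rm part}$ with permutation $P$ and sparsity pattern $(Q_i)_{i=1}^n$. Then $\hat A_{\rm part} + \hat A_{\rm res}$ can be rewritten as a Vecchia approximation of $A$ with permutation $P$ and the augmented sparsity pattern $$S_i = \bigl(\{1,\ldots,r\} \cup Q_i\bigr) \cap \{1,\ldots,i-1\}, \qquad i = 1,\ldots,n.$$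
   Context: Positive-semidefinite matrices are Hermitian; $M^*$ is the conjugate transpose and $M^{-*}=(M^{-1})^*$. For index sets $S,T$, $M(S,T)$ denotes the corresponding submatrix. A sparsity pattern $(S_i)_{i=1}^n$ is a sequence of index sets $S_i\subseteq\{1,\ldots,i-1\}$. A lower triangular matrix with ones on the diagonal has sparsity pattern $(S_i)_{i=1}^n$ if, for each $i$, the off-diagonal entries of its row $i$ are zero outside the columns indexed by $S_i$ (entries in $S_i$ are allowed, but not required, to be nonzero). Partial pivoted Cholesky approximation. For a positive-semidefinite $A\in\mathbb{C}^{n\times n}$, a partial pivoted Cholesky approximation with permutation $P$ and approximation rank $r$ is a matrix $\hat A = P\hat L\hat D\hat L^*P^*$, where $\hat D$ is a diagonal matrix with nonnegative entries, $\hat L$ is lower triangular with ones on the diagonal and has sparsity pattern $\{1,\ldots,r\}\cap\{1,\ldots,i-1\}$ in row $i$, such that the first $r$ rows and columns of $\hat L\hat D\hat L^*$ match the first $r$ rows and columns of $\tilde A = P^*AP$, and the last $n-r$ diagonal entries of $\hat D$ are zero. Vecchia approximation. For a positive-semidefinite $A\in\mathbb{C}^{n\times n}$, a Vecchia approximation with permutation $P$ and sparsity pattern $(S_i)_{i=1}^n$ is a matrix $\hat A = P\hat C^{-1}\hat D\hat C^{-*}P^*$, where $\hat D$ is a diagonal matrix with nonnegative entries, $\hat C$ is lower triangular with ones on the diagonal and has sparsity pattern $(S_i)_{i=1}^n$, and for every $i=1,\ldots,n$, with $\tilde A = P^*AP$, $$\begin{bmatrix}\hat C(i,S_i) & 1\end{bmatrix}\begin{bmatrix}\tilde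 A(S_i,S_i) & \tilde A(S_i,i)\\ \tilde A(i,S_i) & \tilde A(i,i)\end{bmatrix} = \begin{bmatrix}0 & \hat D(i,i)\end{bmatrix}.$$ *)

theory Defs
  imports "Jordan_Normal_Form.Schur_Decomposition"
begin

text \<open>
  Rows and columns are indexed by \<open>0, \<dots>, n - 1\<close>, so an index set \<open>{1, \<dots>, i - 1}\<close> of the
  usual one-based convention is \<open>{..<i}\<close> here and \<open>{1, \<dots>, r}\<close> is \<open>{..<r}\<close>.
  The conjugate transpose is \<^const>\<open>mat_adjoint\<close>. The order on \<^typ>\<open>complex\<close> is the one of
  \<open>Complex_Order\<close>: \<open>0 \<le> z\<close> says that \<open>z\<close> is real and nonnegative.
\<close>

definition psd_mat :: "nat \<Rightarrow> complex mat \<Rightarrow> bool" where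
  "psd_mat n A \<longleftrightarrow>
     A \<in> carrier_mat n n \<and> mat_adjoint A = A \<and>
     (\<forall>x \<in> carrier_vec n. 0 \<le> (A *\<^sub>v x) \<bullet>c x)"

definition permutation_mat :: "nat \<Rightarrow> complex mat \<Rightarrow> bool" where
  "permutation_mat n P \<longleftrightarrow>
     P \<in> carrier_mat n n \<and>
     (\<forall>i<n. \<forall>j<n. P $$ (i, j) \<in> {0, 1}) \<and>
     (\<forall>i<n. \<exists>!j. j < n \<and> P $$ (i, j) = 1) \<and>
     (\<forall>j<n. \<exists>!i. i < n \<and> P $$ (i, j) = 1)"

definition sparsity_pattern :: "nat \<Rightarrow> (nat \<Rightarrow> nat set) \<Rightarrow> bool" where
  "sparsity_pattern n S \<longleftrightarrow> (\<forall>i<n. S i \<subseteq> {..<i})"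

definition unit_lower_triangular :: "nat \<Rightarrow> complex mat \<Rightarrow> bool" where
  "unit_lower_triangular n M \<longleftrightarrow>
     M \<in> carrier_mat n n \<and>
     (\<forall>i<n. M $$ (i, i) = 1) \<and>
     (\<forall>i<n. \<forall>j<n. i < j \<longrightarrow> M $$ (i, j) = 0)"

definition has_sparsity_pattern :: "nat \<Rightarrow> complex mat \<Rightarrow> (nat \<Rightarrow> nat set) \<Rightarrow> bool" where
  "has_sparsity_pattern n M S \<longleftrightarrow>
     (\<forall>i<n. \<forall>j<n. j \<noteq> i \<longrightarrow> j \<notin> S i \<longrightarrow> M $$ (i, j) = 0)"

definition nonneg_diagonal_mat :: "nat \<Rightarrow> complex mat \<Rightarrow> bool" where
  "nonneg_diagonal_mat n D \<longleftrightarrow>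
     D \<in> carrier_mat n n \<and> diagonal_mat D \<and> (\<forall>i<n. 0 \<le> D $$ (i, i))"

definition partial_cholesky_approx ::
    "nat \<Rightarrow> complex mat \<Rightarrow> complex mat \<Rightarrow> nat \<Rightarrow> complex mat \<Rightarrow> bool" where
  "partial_cholesky_approx n A P r A' \<longleftrightarrow>
     (\<exists>L D.
        nonneg_diagonal_mat n D \<and>
        unit_lower_triangular n L \<and>
        has_sparsity_pattern n L (\<lambda>i. {..<r} \<inter> {..<i}) \<and>
        A' = P * (L * D * mat_adjoint L) * mat_adjoint P \<and>
        (\<forall>i<n. \<forall>j<n. i < r \<or> j < r \<longrightarrow>
           (L * D * mat_adjoint L) $$ (i, j) = (mat_adjoint P * A * P) $$ (i, j)) \<and>
        (\<forall>i<n. r \<le> i \<longrightarrow> D $$ (i, i) = 0))"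

text \<open>
  The row equation
  \<open>[C(i,S\<^sub>i) 1] [[B(S\<^sub>i,S\<^sub>i), B(S\<^sub>i,i)], [B(i,S\<^sub>i), B(i,i)]] = [0 D(i,i)]\<close>, written out
  column by column; the matrix \<open>B\<close> will be \<open>P\<^sup>* A P\<close>.
\<close>

definition vecchia_row_eq ::
    "complex mat \<Rightarrow> complex mat \<Rightarrow> complex mat \<Rightarrow> (nat \<Rightarrow> nat set) \<Rightarrow> nat \<Rightarrow> bool" where
  "vecchia_row_eq B C D S i \<longleftrightarrow>
     (\<forall>j \<in> S i. (\<Sum>k\<in>S i. C $$ (i, k) * B $$ (k, j)) + B $$ (i, j) = 0) \<and>
     (\<Sum>k\<in>S i. C $$ (i, k) * B $$ (k, i)) + B $$ (i, i) = D $$ (i, i)"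

text \<open>In the definition below, \<open>E\<close> is the inverse of \<open>C\<close>.\<close>

definition vecchia_approx ::
    "nat \<Rightarrow> complex mat \<Rightarrow> complex mat \<Rightarrow> (nat \<Rightarrow> nat set) \<Rightarrow> complex mat \<Rightarrow> bool" where
  "vecchia_approx n A P S A' \<longleftrightarrow>
     sparsity_pattern n S \<and>
     (\<exists>C E D.
        nonneg_diagonal_mat n D \<and>
        unit_lower_triangular n C \<and>
        has_sparsity_pattern n C S \<and>
        E \<in> carrier_mat n n \<and> inverts_mat C E \<and> inverts_mat E C \<and>
        A' = P * (E * D * mat_adjoint E) * mat_adjoint P \<and>
        (\<forall>i<n. vecchia_row_eq (mat_adjoint P * A * P) C D S i))"

end

theory Submission
  imports Defs
begin

text \<open>
  Let \<open>B = P\<^sup>* A P\<close>, let \<open>X = L D L\<^sup>*\<close> be the partial Cholesky approximation in the permuted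
  coordinates, \<open>R = B - X\<close> the permuted residual, and \<open>E G E\<^sup>*\<close>, with \<open>E = C\<^sup>-\<^sup>1\<close>, its Vecchia
  approximation. Since \<open>P\<close> is unitary, it suffices to write \<open>X + E G E\<^sup>*\<close> in the form
  \<open>F (D + G) F\<^sup>*\<close> and to verify the row equations of \<open>K = F\<^sup>-\<^sup>1\<close> for \<open>B\<close>.

  The two diagonal factors live on complementary indices. By definition \<open>D\<close> vanishes from index
  \<open>r\<close> on. Conversely \<open>R\<close> vanishes in its first \<open>r\<close> rows and columns, so the Vecchia row
  equations force \<open>G\<close> to vanish on the first \<open>r\<close> indices. Hence only the first \<open>r\<close> columns of
  \<open>L\<close> and the remaining columns of \<open>E\<close> matter, and one can take \<open>F\<close> to consist of exactly these
  columns: then \<open>X = F D F\<^sup>*\<close> and \<open>E G E\<^sup>* = F G F\<^sup>*\<close> (\<open>congruence_diagonal_cong\<close>). The matrix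
  \<open>F\<close> is again unit lower triangular, hence so is its inverse \<open>K\<close>.

  The key point is that \<open>K\<close> and \<open>C\<close> agree in all columns from \<open>r\<close> on
  (\<open>inverse_agrees_on_trailing_columns\<close>). This has two consequences. The entries of \<open>K\<close> below
  the diagonal outside the first \<open>r\<close> columns are those of \<open>C\<close>, which gives the augmented
  sparsity pattern; and \<open>K R = C R\<close>, because the rows of \<open>R\<close> that meet the other columns are
  zero. Therefore
    \<open>K B = K X + K R = D F\<^sup>* + C R\<close>.
  Here \<open>D F\<^sup>*\<close> is upper triangular with diagonal \<open>D\<close>, while row \<open>i\<close> of \<open>C R\<close> vanishes on the
  first \<open>r\<close> columns and on \<open>Q i\<close> and has the diagonal entry \<open>G\<^sub>i\<^sub>i\<close>. So row \<open>i\<close> of \<open>K B\<close> vanishes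
  on the augmented pattern and has the diagonal entry \<open>D\<^sub>i\<^sub>i + G\<^sub>i\<^sub>i\<close>, which is what the row
  equations say once they are read as statements about a product of full matrices
  (\<open>vecchia_row_eq_iff\<close>).
\<close>

section \<open>Adjoints and congruences of diagonal matrices\<close>

lemma mat_adjoint_carrier:
  assumes "M \<in> carrier_mat m n"
  shows "mat_adjoint M \<in> carrier_mat n m"
  using assms by (simp add: mat_adjoint_def mat_of_rows_def)

lemma index_mat_adjoint:
  fixes M :: "complex mat"
  assumes "M \<in> carrier_mat m n" "i < n" "j < m"
  shows "mat_adjoint M $$ (i, j) = cnj (M $$ (j, i))"
  using assms by (simp add: mat_adjoint_def mat_of_rows_def)

lemma index_mult_sum:
  assumes "M \<in> carrier_mat m n" "N \<in> carrier_mat n p" "i < m" "j < p"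
  shows "(M * N) $$ (i, j) = (\<Sum>k<n. M $$ (i, k) * N $$ (k, j))"
  using assms by (simp add: scalar_prod_def atLeast0LessThan)

lemma index_diagonal_mult:
  fixes D :: "complex mat"
  assumes D: "D \<in> carrier_mat n n" "diagonal_mat D"
    and M: "M \<in> carrier_mat n p" and ij: "i < n" "j < p"
  shows "(D * M) $$ (i, j) = D $$ (i, i) * M $$ (i, j)"
proof -
  have "(D * M) $$ (i, j) = (\<Sum>k<n. D $$ (i, k) * M $$ (k, j))"
    by (rule index_mult_sum[OF D(1) M ij])
  also have "\<dots> = (\<Sum>k<n. if k = i then D $$ (i, i) * M $$ (i, j) else 0)"
    using D ij by (intro sum.cong) (auto simp: diagonal_mat_def)
  finally show ?thesis using ij by simp
qed

lemma index_congruence_diagonal: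
  fixes F D :: "complex mat"
  assumes F: "F \<in> carrier_mat n n" and D: "D \<in> carrier_mat n n" "diagonal_mat D"
    and ij: "i < n" "j < n"
  shows "(F * D * mat_adjoint F) $$ (i, j) =
    (\<Sum>k<n. F $$ (i, k) * D $$ (k, k) * cnj (F $$ (j, k)))"
proof -
  note F' = mat_adjoint_carrier[OF F]
  have "F * D * mat_adjoint F = F * (D * mat_adjoint F)"
    using F D(1) F' by (rule assoc_mult_mat)
  then have "(F * D * mat_adjoint F) $$ (i, j) =
      (\<Sum>k<n. F $$ (i, k) * (D * mat_adjoint F) $$ (k, j))"
    using index_mult_sum[OF F mult_carrier_mat[OF D(1) F'] ij] by simp
  also have "\<dots> = (\<Sum>k<n. F $$ (i, k) * D $$ (k, k) * cnj (F $$ (j, k)))"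
    using ij by (intro sum.cong)
      (auto simp: index_diagonal_mult[OF D F'] index_mat_adjoint[OF F])
  finally show ?thesis .
qed

text \<open>
  Column \<open>k\<close> of \<open>F\<close> contributes to \<open>F D F\<^sup>*\<close> with weight \<open>D\<^sub>k\<^sub>k\<close>, so columns of weight zero can be
  exchanged freely. This is how the Cholesky factor and the Vecchia factor are merged into one.
\<close>

lemma congruence_diagonal_cong:
  fixes F G D :: "complex mat"
  assumes F: "F \<in> carrier_mat n n" and G: "G \<in> carrier_mat n n"
    and D: "D \<in> carrier_mat n n" "diagonal_mat D"
    and eq: "\<And>i k. i < n \<Longrightarrow> k < n \<Longrightarrow> D $$ (k, k) \<noteq> 0 \<Longrightarrow> F $$ (i, k) = G $$ (i, k)"
  shows "F * D * mat_adjoint F = G * D * mat_adjoint G"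
proof (rule eq_matI)
  fix i j
  assume "i < dim_row (G * D * mat_adjoint G)" "j < dim_col (G * D * mat_adjoint G)"
  then have ij: "i < n" "j < n" using G mat_adjoint_carrier[OF G] by auto
  have "F $$ (i, k) * D $$ (k, k) * cnj (F $$ (j, k)) =
      G $$ (i, k) * D $$ (k, k) * cnj (G $$ (j, k))" if "k < n" for k
    using eq[OF ij(1) that] eq[OF ij(2) that] by (cases "D $$ (k, k) = 0") auto
  then show "(F * D * mat_adjoint F) $$ (i, j) = (G * D * mat_adjoint G) $$ (i, j)"
    unfolding index_congruence_diagonal[OF F D ij] index_congruence_diagonal[OF G D ij]
    by (intro sum.cong) auto
qed (use F G mat_adjoint_carrier[OF F] mat_adjoint_carrier[OF G] in auto)

section \<open>Inverses of unit lower triangular matrices\<close>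

text \<open>
  Forward substitution: row \<open>i\<close> of \<open>M N = 1\<close> expresses \<open>N\<^sub>i\<^sub>j\<close> through the entries \<open>N\<^sub>k\<^sub>j\<close> with
  \<open>k < i\<close>, all of which vanish by induction when \<open>i \<le> j\<close>.
\<close>

lemma unit_lower_triangular_right_inverse:
  assumes M: "unit_lower_triangular n M" and N: "N \<in> carrier_mat n n" and MN: "M * N = 1\<^sub>m n"
  shows "unit_lower_triangular n N"
proof -
  have Mc: "M \<in> carrier_mat n n" using M by (simp add: unit_lower_triangular_def)
  have row: "i < n \<Longrightarrow> i \<le> j \<Longrightarrow> j < n \<Longrightarrow> N $$ (i, j) = (if i = j then 1 else 0)" for i j
  proof (induction i rule: less_induct)
    case (less i)
    have "(\<Sum>k<n. M $$ (i, k) * N $$ (k, j)) = (\<Sum>k<n. if k = i then N $$ (i, j) else 0)"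
    proof (rule sum.cong)
      fix k assume k: "k \<in> {..<n}"
      show "M $$ (i, k) * N $$ (k, j) = (if k = i then N $$ (i, j) else 0)"
        using less.IH[of k] less.prems k M
        by (cases k i rule: linorder_cases) (auto simp: unit_lower_triangular_def)
    qed simp
    moreover have "(\<Sum>k<n. M $$ (i, k) * N $$ (k, j)) = (1\<^sub>m n) $$ (i, j)"
      unfolding MN[symmetric] using index_mult_sum[OF Mc N] less.prems by simp
    ultimately show ?case using less.prems by simp
  qed
  then show ?thesis using N unfolding unit_lower_triangular_def by auto
qed

lemma unit_lower_triangular_inverse_exists:
  assumes M: "unit_lower_triangular n M"
  obtains N where "unit_lower_triangular n N" "N * M = 1\<^sub>m n" "M * N = 1\<^sub>m n"
proof -
  have Mc: "M \<in> carrier_mat n n" using M by (simp add: unit_lower_triangular_def)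
  have "det M = prod_list (diag_mat M)"
    using M by (intro det_lower_triangular[OF _ Mc]) (auto simp: unit_lower_triangular_def)
  also have "diag_mat M = map (\<lambda>i. 1) [0..<n]"
    using M Mc by (auto simp: diag_mat_def unit_lower_triangular_def)
  also have "prod_list \<dots> = 1" by (induction n) auto
  finally have "det M \<noteq> 0" by simp
  from det_non_zero_imp_unit[OF Mc this] obtain N where
    N: "N \<in> carrier_mat n n" "N * M = 1\<^sub>m n" "M * N = 1\<^sub>m n"
    by (auto simp: Units_def ring_mat_def)
  with unit_lower_triangular_right_inverse[OF M] that show thesis by blast
qed

text \<open>
  Multiply \<open>C' E\<close> by \<open>C = E\<^sup>-\<^sup>1\<close>: column \<open>j\<close> of \<open>C' = (C' E) C\<close> combines only columns \<open>k \<ge> j\<close> of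
  \<open>C' E\<close>, since \<open>C\<close> is lower triangular. For \<open>j \<ge> r\<close> these are columns of \<open>C' E' = 1\<close>, because
  \<open>E\<close> and \<open>E'\<close> agree there. So the trailing columns of an inverse do not depend on the leading
  columns of the matrix.
\<close>

lemma inverse_agrees_on_trailing_columns:
  fixes C C' E E' :: "complex mat"
  assumes C: "unit_lower_triangular n C" "E \<in> carrier_mat n n" "E * C = 1\<^sub>m n"
    and C': "C' \<in> carrier_mat n n" "E' \<in> carrier_mat n n" "C' * E' = 1\<^sub>m n"
    and eq: "\<And>k l. k < n \<Longrightarrow> l < n \<Longrightarrow> r \<le> l \<Longrightarrow> E' $$ (k, l) = E $$ (k, l)"
    and ij: "i < n" "j < n" "r \<le> j"
  shows "C' $$ (i, j) = C $$ (i, j)"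
proof -
  have Cc: "C \<in> carrier_mat n n" using C by (simp add: unit_lower_triangular_def)
  have col: "(C' * E) $$ (i, k) = 1\<^sub>m n $$ (i, k)" if k: "k < n" "r \<le> k" for k
    unfolding C'(3)[symmetric] index_mult_sum[OF C'(1) C(2) ij(1) k(1)]
      index_mult_sum[OF C'(1) C'(2) ij(1) k(1)]
    using eq k by (intro sum.cong) auto
  have "C' = (C' * E) * C"
    using assoc_mult_mat[OF C'(1) C(2) Cc] C(3) C'(1) by simp
  then have "C' $$ (i, j) = ((C' * E) * C) $$ (i, j)" by simp
  also have "\<dots> = (\<Sum>k<n. (C' * E) $$ (i, k) * C $$ (k, j))"
    by (rule index_mult_sum[OF mult_carrier_mat[OF C'(1) C(2)] Cc ij(1,2)])
  also have "\<dots> = (\<Sum>k<n. if k = i then C $$ (i, j) else 0)"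
  proof (rule sum.cong)
    fix k assume k: "k \<in> {..<n}"
    show "(C' * E) $$ (i, k) * C $$ (k, j) = (if k = i then C $$ (i, j) else 0)"
    proof (cases "k < j")
      case True
      then show ?thesis using C(1) k ij by (auto simp: unit_lower_triangular_def)
    next
      case False
      then show ?thesis using col[of k] k ij by auto
    qed
  qed simp
  finally show ?thesis using ij by simp
qed

section \<open>Permutation matrices\<close>

lemma permutation_mat_unitary:
  assumes P: "permutation_mat n P"
  shows "mat_adjoint P * P = 1\<^sub>m n"
proof (rule eq_matI)
  have Pc: "P \<in> carrier_mat n n" using P by (simp add: permutation_mat_def)
  note P' = mat_adjoint_carrier[OF Pc]
  show "dim_row (mat_adjoint P * P) = dim_row (1\<^sub>m n)"
    "dim_col (mat_adjoint P * P) = dim_col (1\<^sub>m n)" using Pc P' by auto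
  fix i j assume "i < dim_row (1\<^sub>m n :: complex mat)" "j < dim_col (1\<^sub>m n :: complex mat)"
  then have ij: "i < n" "j < n" by auto
  have entry: "P $$ (k, l) \<in> {0, 1}" if "k < n" "l < n" for k l
    using P that by (simp add: permutation_mat_def)
  have colI: "\<exists>!k. k < n \<and> P $$ (k, i) = 1" and rowI: "\<And>k. k < n \<Longrightarrow> \<exists>!l. l < n \<and> P $$ (k, l) = 1"
    using P ij(1) by (simp_all add: permutation_mat_def)
  from colI obtain m where m: "m < n" "P $$ (m, i) = 1"
    and uniq: "\<And>k. k < n \<Longrightarrow> P $$ (k, i) = 1 \<Longrightarrow> k = m"
    by blast
  have col: "P $$ (k, i) = (if k = m then 1 else 0)" if "k < n" for k
  proof (cases "k = m")
    case False
    with uniq[OF that] have "P $$ (k, i) \<noteq> 1" by blast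
    with entry[OF that ij(1)] False show ?thesis by simp
  qed (simp add: m)
  have row: "P $$ (m, j) = (if i = j then 1 else 0)"
  proof (cases "i = j")
    case False
    with rowI[OF m(1)] m(2) ij have "P $$ (m, j) \<noteq> 1" by blast
    with entry[OF m(1) ij(2)] False show ?thesis by simp
  qed (use m in simp)
  have "(mat_adjoint P * P) $$ (i, j) = (\<Sum>k<n. cnj (P $$ (k, i)) * P $$ (k, j))"
    unfolding index_mult_sum[OF P' Pc ij] using ij
    by (intro sum.cong) (auto simp: index_mat_adjoint[OF Pc])
  also have "\<dots> = (\<Sum>k<n. if k = m then P $$ (m, j) else 0)"
    by (intro sum.cong) (auto simp: col)
  finally show "(mat_adjoint P * P) $$ (i, j) = 1\<^sub>m n $$ (i, j)"
    using m row ij by simp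
qed

section \<open>Augmenting a Vecchia approximation by a partial Cholesky factor\<close>

text \<open>
  The row vector \<open>[C(i, S\<^sub>i) 1]\<close> is row \<open>i\<close> of \<open>C\<close> with entries outside its support removed. In
  this form the row equations can be combined by matrix algebra, and equations for different
  index sets become comparable.
\<close>

lemma vecchia_row_eq_iff:
  assumes C: "unit_lower_triangular n C" "has_sparsity_pattern n C S"
    and S: "S i \<subseteq> {..<i}" and B: "B \<in> carrier_mat n n" and i: "i < n"
  shows "vecchia_row_eq B C D S i \<longleftrightarrow>
    (\<forall>j \<in> S i. (C * B) $$ (i, j) = 0) \<and> (C * B) $$ (i, i) = D $$ (i, i)"
proof -
  have Cc: "C \<in> carrier_mat n n" using C by (simp add: unit_lower_triangular_def)
  have "(C * B) $$ (i, j) = (\<Sum>k\<in>S i. C $$ (i, k) * B $$ (k, j)) + B $$ (i, j)" if j: "j < n" for j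
  proof -
    have "finite (S i)" and "i \<notin> S i" using S finite_subset by auto
    have "(C * B) $$ (i, j) = (\<Sum>k<n. C $$ (i, k) * B $$ (k, j))"
      by (rule index_mult_sum[OF Cc B i j])
    also have "\<dots> = (\<Sum>k\<in>insert i (S i). C $$ (i, k) * B $$ (k, j))"
      using S i C(2) by (intro sum.mono_neutral_right) (auto simp: has_sparsity_pattern_def)
    also have "\<dots> = (\<Sum>k\<in>S i. C $$ (i, k) * B $$ (k, j)) + B $$ (i, j)"
      using \<open>finite (S i)\<close> \<open>i \<notin> S i\<close> C(1) i by (simp add: unit_lower_triangular_def)
    finally show ?thesis .
  qed
  moreover have "j < n" if "j \<in> S i" for j using that S i by auto
  ultimately show ?thesis using i unfolding vecchia_row_eq_def by auto
qed

theorem theorem2p4: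
  fixes n r :: nat
    and A P Apart Ares :: "complex mat"
    and Q :: "nat \<Rightarrow> nat set"
  assumes "psd_mat n A"
    and "permutation_mat n P"
    and "sparsity_pattern n Q"
    and "partial_cholesky_approx n A P r Apart"
    and "vecchia_approx n (A - Apart) P Q Ares"
  shows "vecchia_approx n A P (\<lambda>i. ({..<r} \<union> Q i) \<inter> {..<i}) (Apart + Ares)"
proof -
  let ?S = "\<lambda>i. ({..<r} \<union> Q i) \<inter> {..<i}"
  have A: "A \<in> carrier_mat n n" using assms(1) by (simp add: psd_mat_def)
  have P: "P \<in> carrier_mat n n" using assms(2) by (simp add: permutation_mat_def)
  note Pa = mat_adjoint_carrier[OF P]
  note PP = permutation_mat_unitary[OF assms(2)]
  define B where "B = mat_adjoint P * A * P"
  have B: "B \<in> carrier_mat n n" unfolding B_def using A P Pa by auto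
  obtain L D where D: "nonneg_diagonal_mat n D" and L: "unit_lower_triangular n L"
    and Apart: "Apart = P * (L * D * mat_adjoint L) * mat_adjoint P"
    and match: "\<And>i j. i < n \<Longrightarrow> j < n \<Longrightarrow> i < r \<or> j < r \<Longrightarrow>
        (L * D * mat_adjoint L) $$ (i, j) = B $$ (i, j)"
    and D0: "\<And>i. i < n \<Longrightarrow> r \<le> i \<Longrightarrow> D $$ (i, i) = 0"
    using assms(4) unfolding partial_cholesky_approx_def B_def by metis
  define X where "X = L * D * mat_adjoint L"
  define R where "R = mat_adjoint P * (A - Apart) * P"
  obtain C E G where G: "nonneg_diagonal_mat n G" and C: "unit_lower_triangular n C"
    and Csp: "has_sparsity_pattern n C Q" and E: "E \<in> carrier_mat n n"
    and inv: "inverts_mat C E" "inverts_mat E C"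
    and Ares: "Ares = P * (E * G * mat_adjoint E) * mat_adjoint P"
    and rows: "\<And>i. i < n \<Longrightarrow> vecchia_row_eq R C G Q i"
    using assms(5) unfolding vecchia_approx_def R_def by metis
  define Y where "Y = E * G * mat_adjoint E"
  have Dc: "D \<in> carrier_mat n n" "diagonal_mat D" and Gc: "G \<in> carrier_mat n n" "diagonal_mat G"
    using D G by (auto simp: nonneg_diagonal_mat_def)
  have Lc: "L \<in> carrier_mat n n" and Cc: "C \<in> carrier_mat n n"
    using L C by (auto simp: unit_lower_triangular_def)
  have CE: "C * E = 1\<^sub>m n" and EC: "E * C = 1\<^sub>m n"
    using inv Cc E by (auto simp: inverts_mat_def)
  have Elow: "unit_lower_triangular n E"
    by (rule unit_lower_triangular_right_inverse[OF C E CE])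
  have X: "X \<in> carrier_mat n n" and Y: "Y \<in> carrier_mat n n"
    unfolding X_def Y_def using Lc Dc E Gc mat_adjoint_carrier[OF Lc] mat_adjoint_carrier[OF E]
    by auto
  have Rc: "R \<in> carrier_mat n n"
    unfolding R_def using A Apart X P Pa by (auto simp: X_def[symmetric])

  \<comment> \<open>Passing to permuted coordinates, where the residual becomes \<open>B - X\<close>.\<close>
  have "mat_adjoint P * (P * X * mat_adjoint P) * P =
      (mat_adjoint P * P) * X * (mat_adjoint P * P)"
    using P Pa X by (simp add: assoc_mult_mat[of _ n n _ n _ n])
  then have cancel: "mat_adjoint P * (P * X * mat_adjoint P) * P = X"
    using PP X by simp
  have R: "R = B - X"
  proof -
    have PX: "P * X * mat_adjoint P \<in> carrier_mat n n" using P Pa X by auto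
    have "R = mat_adjoint P * A * P - mat_adjoint P * (P * X * mat_adjoint P) * P"
      unfolding R_def Apart X_def[symmetric] mult_minus_distrib_mat[OF Pa A PX]
      by (rule minus_mult_distrib_mat[OF mult_carrier_mat[OF Pa A] mult_carrier_mat[OF Pa PX] P])
    then show ?thesis unfolding cancel B_def .
  qed
  have R0: "R $$ (i, j) = 0" if "i < n" "j < n" "i < r \<or> j < r" for i j
    using match[OF that] that B X unfolding R X_def[symmetric] by simp

  have Qi: "Q i \<subseteq> {..<i}" if "i < n" for i
    using assms(3) that by (simp add: sparsity_pattern_def)
  have CR: "(\<forall>j \<in> Q i. (C * R) $$ (i, j) = 0) \<and> (C * R) $$ (i, i) = G $$ (i, i)"
    if "i < n" for i
    using rows[OF that] vecchia_row_eq_iff[OF C Csp Qi[OF that] Rc that] by blast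
  have CR0: "(C * R) $$ (i, j) = 0" if "i < n" "j < n" "j < r" for i j
    using that by (simp add: index_mult_sum[OF Cc Rc] R0)
  \<comment> \<open>For \<open>i < r\<close> the diagonal equation of row \<open>i\<close> has right-hand side \<open>G\<^sub>i\<^sub>i\<close> and, as column \<open>i\<close>
    of \<open>R\<close> is zero, left-hand side 0.\<close>
  have G0: "G $$ (i, i) = 0" if "i < n" "i < r" for i
    using CR[OF that(1)] CR0[OF that(1) that] by simp

  \<comment> \<open>The columns of \<open>L\<close> carrying the weights \<open>D\<close> and those of \<open>E\<close> carrying the weights \<open>G\<close>.\<close>
  define F where "F = mat n n (\<lambda>(i, j). if j < r then L $$ (i, j) else E $$ (i, j))"
  have Flow: "unit_lower_triangular n F"
    using L Elow by (auto simp: F_def unit_lower_triangular_def)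
  have F: "F \<in> carrier_mat n n" by (simp add: F_def)
  note Fa = mat_adjoint_carrier[OF F]
  obtain K where Klow: "unit_lower_triangular n K" and KF: "K * F = 1\<^sub>m n" and FK: "F * K = 1\<^sub>m n"
    using Flow by (rule unit_lower_triangular_inverse_exists)
  have K: "K \<in> carrier_mat n n" using Klow by (simp add: unit_lower_triangular_def)
  have KC: "K $$ (i, j) = C $$ (i, j)" if "i < n" "j < n" "r \<le> j" for i j
    by (rule inverse_agrees_on_trailing_columns[OF C E EC K F KF _ that]) (simp add: F_def)
  have FX: "X = F * D * mat_adjoint F" unfolding X_def
    by (rule congruence_diagonal_cong[OF Lc F Dc]) (use D0 in \<open>force simp: F_def\<close>)
  have FY: "Y = F * G * mat_adjoint F" unfolding Y_def
    by (rule congruence_diagonal_cong[OF E F Gc]) (use G0 in \<open>force simp: F_def\<close>)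

  have DG: "nonneg_diagonal_mat n (D + G)"
    using D G by (auto simp: nonneg_diagonal_mat_def diagonal_mat_def)
  have Ksp: "has_sparsity_pattern n K ?S"
    unfolding has_sparsity_pattern_def
  proof (intro allI impI)
    fix i j assume ij: "i < n" "j < n" "j \<noteq> i" "j \<notin> ?S i"
    show "K $$ (i, j) = 0"
    proof (cases "i < j")
      case True
      then show ?thesis using Klow ij by (auto simp: unit_lower_triangular_def)
    next
      case False
      then have "r \<le> j" "j \<notin> Q i" using ij by auto
      then show ?thesis using KC ij Csp by (auto simp: has_sparsity_pattern_def)
    qed
  qed
  have sum: "Apart + Ares = P * (F * (D + G) * mat_adjoint F) * mat_adjoint P"
  proof -
    have "F * (D + G) * mat_adjoint F = X + Y"
      unfolding FX FY mult_add_distrib_mat[OF F Dc(1) Gc(1)]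
      by (rule add_mult_distrib_mat[OF mult_carrier_mat[OF F Dc(1)] mult_carrier_mat[OF F Gc(1)] Fa])
    then show ?thesis
      unfolding Apart Ares X_def[symmetric] Y_def[symmetric]
      using P Pa X Y by (simp add: mult_add_distrib_mat[OF P X Y]
          add_mult_distrib_mat[OF mult_carrier_mat[OF P X] mult_carrier_mat[OF P Y] Pa])
  qed
  \<comment> \<open>Where \<open>K\<close> and \<open>C\<close> may differ, in column \<open>k < r\<close>, they meet the zero row \<open>k\<close> of \<open>R\<close>.\<close>
  have KR: "(K * R) $$ (i, j) = (C * R) $$ (i, j)" if "i < n" "j < n" for i j
    unfolding index_mult_sum[OF K Rc that] index_mult_sum[OF Cc Rc that]
  proof (rule sum.cong)
    fix k assume "k \<in> {..<n}"
    then show "K $$ (i, k) * R $$ (k, j) = C $$ (i, k) * R $$ (k, j)"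
      using KC[of i k] R0[of k j] that by (cases "k < r") auto
  qed simp
  have KX: "K * X = D * mat_adjoint F"
  proof -
    have "K * X = (K * F) * (D * mat_adjoint F)"
      unfolding FX using K F Dc Fa by (simp add: assoc_mult_mat[of _ n n _ n _ n])
    then show ?thesis using KF Dc Fa by simp
  qed
  have KB: "(K * B) $$ (i, j) = D $$ (i, i) * cnj (F $$ (j, i)) + (C * R) $$ (i, j)"
    if ij: "i < n" "j < n" for i j
  proof -
    have "B = X + R" unfolding R using B X by auto
    then have "K * B = K * X + K * R" using K X Rc by (simp add: mult_add_distrib_mat)
    then have "(K * B) $$ (i, j) = (K * X) $$ (i, j) + (K * R) $$ (i, j)"
      using ij K Rc by simp
    then show ?thesis unfolding KX KR[OF ij] index_diagonal_mult[OF Dc Fa ij]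
      using ij by (simp add: index_mat_adjoint[OF F])
  qed
  have "vecchia_row_eq B K (D + G) ?S i" if i: "i < n" for i
  proof -
    have "(K * B) $$ (i, j) = 0" if j: "j \<in> ?S i" for j
    proof -
      have "F $$ (j, i) = 0" using Flow j i by (auto simp: unit_lower_triangular_def)
      moreover have "(C * R) $$ (i, j) = 0" using j i CR[OF i] CR0[OF i, of j] by auto
      ultimately show ?thesis using KB[OF i, of j] j i by auto
    qed
    moreover have "(K * B) $$ (i, i) = (D + G) $$ (i, i)"
      using KB[OF i i] CR[OF i] Flow i Gc by (simp add: unit_lower_triangular_def)
    ultimately show ?thesis
      using vecchia_row_eq_iff[OF Klow Ksp _ B i] by auto
  qed
  then show ?thesis
    unfolding vecchia_approx_def sparsity_pattern_def
    using DG Klow Ksp F KF FK K sum unfolding B_def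
    by (intro conjI exI[of _ K] exI[of _ F] exI[of _ "D + G"]) (auto simp: inverts_mat_def)
qed

end
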